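(* Given the unit patterns $q_h=\{q_h[1],\dots,q_h[|q_h|]\}$ of the $h$-th type in a query community $Q$, and a similarity threshold $\theta$, we say that a unit pattern $c_h[j]$ (of type $h$) is a candidate unit pattern if its summed cosine similarity to the unit patterns in $q_h$ is greater than or equal to $\frac{\theta\cdot|q_h|}{\max\{|c_h|\}}$, that is, if $$\sum_{i=1}^{|q_h|}cos\_sim(c_h[j],\,q_h[i])\;\ge\;\frac{\theta\cdot|q_h|}{\max\{|c_h|\}},$$ where $\max\{|c_h|\}$ is the maximum count of unit patterns of type $h$, over all communities containing $c_h[j]$.
   Context: A road-network graph $G$ is a connected planar graph whose edges are road segments and whose vertices are intersection points of road segments. $G$ is divided into non-overlapping unit patterns: a unit pattern is either a single edge not lying on a cycle, or a polygon given by a simple cycle (triangle, rectangle, pentagon, hexagon, ...). The type of a unit pattern is its shape; there are $n$ types in total, indexed by $1\le h\le n$. Each unit pattern $c$ has a point-of-interest (POI) vector $c.vec$, whose entries are the counts of the different types of points of interest on it, normalized to Euclidean length $1$. For unit patterns $c$ and $q$ of the same type, $cos\_sim(c,q)$ denotes the cosine similarity of their POI vectors, which by the normalization is the dot product $c.vec\cdot q.vec$. Fix a radius $r$. A spatial community (or community) with center vertex $v_c\in V(G)$ is a connected subgraph of $G$ all of whose unit patterns $c$ satisfy $mindist(c,v_c)\le r$, where $mindist(c,v_c)$ is the minimum Euclidean distance from $v_c$ to $c$. The query community $Q$ is a given community; $q_h[1],\dots,q_h[|q_h|]$ are its unit patterns of type $h$, and $|q_h|$ is their number. For a community $C_l$,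 $c_h[1],\dots,c_h[|c_h|]$ are its unit patterns of type $h$, and $|c_h|$ is their number. The similarity score of $C_l$ and $Q$ is $$sim(C_l,Q)=\sum_{h=1}^{n}\frac{\sum_{i=1}^{|c_h|}\sum_{j=1}^{|q_h|}cos\_sim(c_h[i].vec,\,q_h[j].vec)}{|q_h|\cdot n},$$ and one searches for communities $C_l$ with $sim(C_l,Q)\ge\theta$. Candidate unit patterns are the unit patterns of $G$ that are retrieved in this search and from which the candidate communities are then obtained; the inequality in the claim is the criterion for retrieving a unit pattern, and the term "candidate unit pattern" has no separate definition. *)

theory Defs
  imports "HOL-Analysis.Analysis" "Graph_Theory.Graph_Theory"
begin

text \<open>
  Undirected graphs are represented as in \<^theory>\<open>Graph_Theory.Pair_Digraph\<close>: the locale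
  \<^locale>\<open>pair_graph\<close> describes finite loop-free graphs without parallel edges, an
  undirected edge between \<open>u\<close> and \<open>v\<close> being the two arcs \<open>(u, v)\<close> and \<open>(v, u)\<close>.
  The vertices are points of the Euclidean plane and the edges are straight segments.
  Both libraries have a constant named \<open>connected\<close>; the graph-theoretic one is qualified.
\<close>

type_synonym plane_graph = "(real ^ 2) pair_pre_digraph"

definition seg :: "(real ^ 2) \<times> (real ^ 2) \<Rightarrow> (real ^ 2) set" where
  "seg e = closed_segment (fst e) (snd e)"

definition ends :: "(real ^ 2) \<times> (real ^ 2) \<Rightarrow> (real ^ 2) set" where
  "ends e = {fst e, snd e}"

definition support :: "plane_graph \<Rightarrow> (real ^ 2) set" where
  "support c = (\<Union>e\<in>parcs c. seg e)"

definition plane_embedded :: "plane_graph \<Rightarrow> bool" where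
  "plane_embedded G \<longleftrightarrow>
     (\<forall>e\<in>parcs G. \<forall>f\<in>parcs G. ends e \<noteq> ends f \<longrightarrow> seg e \<inter> seg f \<subseteq> ends e \<inter> ends f)"

text \<open>
  The length bound excludes the closed walk \<open>u, v, u\<close> along a single undirected edge, which
  counts as a cycle for \<^const>\<open>pre_digraph.cycle\<close>.
\<close>

definition simple_cycle :: "plane_graph \<Rightarrow> ((real ^ 2) \<times> (real ^ 2)) list \<Rightarrow> bool" where
  "simple_cycle G p \<longleftrightarrow> pre_digraph.cycle (with_proj G) p \<and> 3 \<le> length p"

definition single_edge_pattern :: "plane_graph \<Rightarrow> plane_graph \<Rightarrow> bool" where
  "single_edge_pattern G c \<longleftrightarrow>
     (\<exists>u v. (u, v) \<in> parcs G \<and> (\<nexists>p. simple_cycle G p \<and> (u, v) \<in> set p) \<and>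
            c = \<lparr> pverts = {u, v}, parcs = {(u, v), (v, u)} \<rparr>)"

definition polygon_pattern :: "plane_graph \<Rightarrow> plane_graph \<Rightarrow> bool" where
  "polygon_pattern G c \<longleftrightarrow>
     (\<exists>p. simple_cycle G p \<and> c = \<lparr> pverts = fst ` set p, parcs = set p \<union> (set p)\<inverse> \<rparr>)"

text \<open>
  A network \<open>G\<close> with its division \<open>P\<close> into unit patterns. Adjacent polygons may share edges,
  so not overlapping means that the regions enclosed are disjoint.
  The shape of a pattern is determined by its number of edges, and \<open>ptype\<close> numbers the
  shapes by \<open>1, \<dots>, n\<close>. The vector \<open>poi c\<close> contains the unnormalized counts of the points of
  interest on \<open>c\<close>; it has to be nonzero to be normalizable.
\<close>

locale road_network = pair_graph G
  for G :: plane_graph +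
  fixes P :: "plane_graph set"
    and n :: nat
    and ptype :: "plane_graph \<Rightarrow> nat"
    and poi :: "plane_graph \<Rightarrow> nat ^ 'k"
  assumes network_connected: "Digraph_Component.connected (with_proj G)"
    and network_planar: "plane_embedded G"
    and pattern_kinds: "\<And>c. c \<in> P \<Longrightarrow> single_edge_pattern G c \<or> polygon_pattern G c"
    and patterns_cover: "parcs G = (\<Union>c\<in>P. parcs c)"
    and patterns_nonoverlapping:
      "\<And>c d. \<lbrakk>c \<in> P; d \<in> P; c \<noteq> d\<rbrakk> \<Longrightarrow> inside (support c) \<inter> inside (support d) = {}"
    and ptype_range: "\<And>c. c \<in> P \<Longrightarrow> ptype c \<in> {1..n}"
    and ptype_shape:
      "\<And>c d. \<lbrakk>c \<in> P; d \<in> P\<rbrakk> \<Longrightarrow> ptype c = ptype d \<longleftrightarrow> card (parcs c) = card (parcs d)"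
    and poi_nonzero: "\<And>c. c \<in> P \<Longrightarrow> poi c \<noteq> 0"

text \<open>\<^const>\<open>sgn\<close> rescales a nonzero vector to Euclidean length 1.\<close>

definition poi_vec :: "(plane_graph \<Rightarrow> nat ^ 'k) \<Rightarrow> plane_graph \<Rightarrow> real ^ 'k" where
  "poi_vec poi c = sgn (\<chi> k. real (poi c $ k))"

definition cos_sim :: "real ^ 'k \<Rightarrow> real ^ 'k \<Rightarrow> real" where
  "cos_sim x y = (x \<bullet> y) / (norm x * norm y)"

definition mindist :: "plane_graph \<Rightarrow> real ^ 2 \<Rightarrow> real" where
  "mindist c v = infdist v (support c)"

definition patterns_of :: "plane_graph set \<Rightarrow> plane_graph \<Rightarrow> plane_graph set" where
  "patterns_of P C = {c \<in> P. subgraph (with_proj c) (with_proj C)}"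

definition patterns_of_type ::
  "plane_graph set \<Rightarrow> (plane_graph \<Rightarrow> nat) \<Rightarrow> plane_graph \<Rightarrow> nat \<Rightarrow> plane_graph set" where
  "patterns_of_type P ptype C h = {c \<in> patterns_of P C. ptype c = h}"

text \<open>
  The unit patterns of a subgraph are the patterns of the division contained in it. A subgraph
  containing none (a lone vertex, for instance) is not counted as a community; its similarity
  to any query would be 0.
\<close>

definition community ::
  "plane_graph \<Rightarrow> plane_graph set \<Rightarrow> real \<Rightarrow> real ^ 2 \<Rightarrow> plane_graph \<Rightarrow> bool" where
  "community G P r v C \<longleftrightarrow>
     v \<in> pverts G \<and> pair_graph C \<and> subgraph (with_proj C) (with_proj G) \<and>
     Digraph_Component.connected (with_proj C) \<and>
     patterns_of P C \<noteq> {} \<and> (\<forall>c\<in>patterns_of P C. mindist c v \<le> r)"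

text \<open>A type that does not occur in \<open>Q\<close> contributes 0 to the similarity.\<close>

definition sim ::
  "plane_graph set \<Rightarrow> nat \<Rightarrow> (plane_graph \<Rightarrow> nat) \<Rightarrow> (plane_graph \<Rightarrow> nat ^ 'k) \<Rightarrow>
     plane_graph \<Rightarrow> plane_graph \<Rightarrow> real" where
  "sim P n ptype poi C Q =
     (\<Sum>h = 1..n.
        (\<Sum>c\<in>patterns_of_type P ptype C h. \<Sum>q\<in>patterns_of_type P ptype Q h.
           cos_sim (poi_vec poi c) (poi_vec poi q)) /
        (real (card (patterns_of_type P ptype Q h)) * real n))"

definition max_count ::
  "plane_graph \<Rightarrow> plane_graph set \<Rightarrow> real \<Rightarrow> (plane_graph \<Rightarrow> nat) \<Rightarrow> nat \<Rightarrow> plane_graph \<Rightarrow> nat" where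
  "max_count G P r ptype h c =
     Max {card (patterns_of_type P ptype C h) | C v. community G P r v C \<and> c \<in> patterns_of P C}"

definition candidate ::
  "plane_graph \<Rightarrow> plane_graph set \<Rightarrow> real \<Rightarrow> (plane_graph \<Rightarrow> nat) \<Rightarrow>
     (plane_graph \<Rightarrow> nat ^ 'k) \<Rightarrow> plane_graph \<Rightarrow> real \<Rightarrow> nat \<Rightarrow> plane_graph \<Rightarrow> bool" where
  "candidate G P r ptype poi Q \<theta> h c \<longleftrightarrow>
     c \<in> P \<and> ptype c = h \<and>
     (\<Sum>q\<in>patterns_of_type P ptype Q h. cos_sim (poi_vec poi c) (poi_vec poi q))
       \<ge> \<theta> * real (card (patterns_of_type P ptype Q h)) / real (max_count G P r ptype h c)"

end

theory Submission
  imports Defs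
begin

text \<open>
  The similarity is the mean over the \<open>n\<close> types of the ratios \<open>S\<^sub>h / |q\<^sub>h|\<close>, where \<open>S\<^sub>h\<close> sums the
  scores of the patterns of type \<open>h\<close> in \<open>C\<close>. If \<open>\<theta> > 0\<close>, some ratio is at least \<open>\<theta>\<close>, and then
  some pattern of that type scores at least the average \<open>S\<^sub>h / |c\<^sub>h| \<ge> \<theta> |q\<^sub>h| / max {|c\<^sub>h|}\<close>.
  If \<open>\<theta> \<le> 0\<close>, every pattern of \<open>C\<close> is a candidate, because counts of points of interest are
  nonnegative and hence so are all cosine similarities.
\<close>

lemma sum_ge_imp_ex_ge_average:
  fixes f :: "'a \<Rightarrow> real"
  assumes "finite A" and "A \<noteq> {}" and "b \<le> (\<Sum>x\<in>A. f x)"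
  shows "\<exists>x\<in>A. b / real (card A) \<le> f x"
proof (rule ccontr)
  assume "\<not> ?thesis"
  then have "(\<Sum>x\<in>A. f x) < (\<Sum>x\<in>A. b / real (card A))"
    using assms(1,2) by (intro sum_strict_mono) auto
  with assms show False
    by simp
qed

lemma cos_sim_poi_vec_nonneg: "0 \<le> cos_sim (poi_vec poi c) (poi_vec poi d)"
proof -
  have "0 \<le> poi_vec poi e $ k" for e k
    by (simp add: poi_vec_def sgn_vec_def)
  then show ?thesis
    by (auto simp: cos_sim_def inner_vec_def intro!: divide_nonneg_nonneg sum_nonneg mult_nonneg_nonneg)
qed

text \<open>A pattern is determined by its vertex set and its arc set, and for subgraphs of the
  finite graph \<open>G\<close> both range over finite power sets. Finiteness thus comes from
  \<open>G\<close>, whatever set \<open>P\<close> is.\<close>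

lemma finite_patterns_of:
  assumes "pair_graph G"
  shows "finite (patterns_of P G)"
proof (rule finite_subset)
  interpret pair_graph G
    by fact
  show "patterns_of P G \<subseteq>
      (\<lambda>(V, A). \<lparr>pverts = V, parcs = A\<rparr>) ` (Pow (pverts G) \<times> Pow (parcs G))"
  proof
    fix c :: "(real ^ 2) pair_pre_digraph"
    assume "c \<in> patterns_of P G"
    then show "c \<in> (\<lambda>(V, A). \<lparr>pverts = V, parcs = A\<rparr>) ` (Pow (pverts G) \<times> Pow (parcs G))"
      by (intro image_eqI[where x = "(pverts c, parcs c)"])
        (auto simp: patterns_of_def subgraph_def)
  qed
  show "finite ((\<lambda>(V, A). \<lparr>pverts = V, parcs = A\<rparr>) ` (Pow (pverts G) \<times> Pow (parcs G)))"
    by simp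
qed

lemma patterns_of_community_subset:
  assumes "community G P r v C"
  shows "patterns_of P C \<subseteq> patterns_of P G"
  using assms by (auto simp: community_def patterns_of_def intro: subgraph_trans)

lemma finite_patterns_of_type:
  assumes "pair_graph G" and "community G P r v C"
  shows "finite (patterns_of_type P ptype C h)"
  using patterns_of_community_subset[OF assms(2)] finite_patterns_of[OF assms(1)]
  by (auto simp: patterns_of_type_def intro: finite_subset)

text \<open>\<open>Max\<close> is meaningful only on a finite set. Every community is a subgraph of
  \<open>G\<close>, so the number of patterns of \<open>G\<close> bounds all counts at once.\<close>

lemma card_patterns_of_type_le_max_count:
  assumes "pair_graph G" and "community G P r v C" and "c \<in> patterns_of P C"
  shows "card (patterns_of_type P ptype C h) \<le> max_count G P r ptype h c"
  unfolding max_count_def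
proof (rule Max_ge)
  have "card (patterns_of_type P ptype D h) \<le> card (patterns_of P G)"
    if "community G P r w D" for D w
    using patterns_of_community_subset[OF that]
    by (intro card_mono finite_patterns_of assms(1)) (auto simp: patterns_of_type_def)
  then show "finite {card (patterns_of_type P ptype C h) | C v.
      community G P r v C \<and> c \<in> patterns_of P C}"
    by (intro finite_subset[OF _ finite_atMost[of "card (patterns_of P G)"]]) auto
qed (use assms in auto)

theorem theorem3:
  fixes G :: plane_graph
    and P :: "plane_graph set"
    and n :: nat
    and ptype :: "plane_graph \<Rightarrow> nat"
    and poi :: "plane_graph \<Rightarrow> nat ^ 'k"
    and r \<theta> :: real
    and Q C :: plane_graph
    and v\<^sub>Q v\<^sub>C :: "real ^ 2"
  assumes "road_network G P n ptype poi"
    and "community G P r v\<^sub>Q Q"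
    and "community G P r v\<^sub>C C"
    and "sim P n ptype poi C Q \<ge> \<theta>"
  shows "\<exists>h\<in>{1..n}. \<exists>c\<in>patterns_of_type P ptype C h.
           candidate G P r ptype poi Q \<theta> h c \<and>
           (\<theta> > 0 \<longrightarrow> patterns_of_type P ptype Q h \<noteq> {})"
proof -
  interpret road_network G P n ptype poi
    by fact
  define q where "q h = patterns_of_type P ptype Q h" for h
  define s where "s h c = (\<Sum>d\<in>q h. cos_sim (poi_vec poi c) (poi_vec poi d))" for h c
  \<comment> \<open>This pattern serves twice: its type shows that \<open>{1..n}\<close> is
    nonempty, as averaging over types requires, and it is the witness when \<open>\<theta>\<close>
    is not positive.\<close>
  obtain c\<^sub>0 where c\<^sub>0: "c\<^sub>0 \<in> patterns_of P C"
    using assms(3) by (auto simp: community_def)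
  then have type_c\<^sub>0: "c\<^sub>0 \<in> P" "ptype c\<^sub>0 \<in> {1..n}"
    using ptype_range by (auto simp: patterns_of_def)
  show ?thesis
  proof (cases "\<theta> > 0")
    case True
    have "\<theta> \<le> (\<Sum>h = 1..n. (\<Sum>c\<in>patterns_of_type P ptype C h. s h c) / (real (card (q h)) * real n))"
      using assms(4) by (simp add: sim_def s_def q_def)
    then obtain h where h: "h \<in> {1..n}"
      and "\<theta> / real (card {1..n})
        \<le> (\<Sum>c\<in>patterns_of_type P ptype C h. s h c) / (real (card (q h)) * real n)"
      using sum_ge_imp_ex_ge_average[of "{1..n}"] type_c\<^sub>0 by blast
    then have ratio: "\<theta> \<le> (\<Sum>c\<in>patterns_of_type P ptype C h. s h c) / real (card (q h))"
      by (simp add: field_simps)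
    \<comment> \<open>Division by zero yields 0, so if \<open>q h\<close> were empty the ratio would
      be 0, below \<open>\<theta>\<close>.\<close>
    with True have card_q: "card (q h) > 0"
      by (intro gr0I) auto
    then have total: "\<theta> * real (card (q h)) \<le> (\<Sum>c\<in>patterns_of_type P ptype C h. s h c)"
      using ratio by (simp add: field_simps)
    moreover have nonempty: "patterns_of_type P ptype C h \<noteq> {}"
      using ratio True by auto
    ultimately obtain c where c: "c \<in> patterns_of_type P ptype C h"
      and score: "\<theta> * real (card (q h)) / real (card (patterns_of_type P ptype C h)) \<le> s h c"
      using sum_ge_imp_ex_ge_average finite_patterns_of_type[OF pair_graph_axioms assms(3)] by blast
    have "card (patterns_of_type P ptype C h) > 0"
      using nonempty finite_patterns_of_type[OF pair_graph_axioms assms(3)] by (simp add: card_gt_0_iff)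
    moreover have "card (patterns_of_type P ptype C h) \<le> max_count G P r ptype h c"
      using c card_patterns_of_type_le_max_count[OF pair_graph_axioms assms(3)] by (auto simp: patterns_of_type_def)
    \<comment> \<open>Enlarging the denominator lowers the threshold because its numerator is
      nonnegative, so beating the average over \<open>C\<close> is enough.\<close>
    ultimately have "\<theta> * real (card (q h)) / real (max_count G P r ptype h c)
        \<le> \<theta> * real (card (q h)) / real (card (patterns_of_type P ptype C h))"
      using True by (intro divide_left_mono) auto
    with score c have "candidate G P r ptype poi Q \<theta> h c"
      by (auto simp: candidate_def s_def q_def patterns_of_type_def patterns_of_def)
    moreover have "q h \<noteq> {}"
      using card_q by auto
    ultimately show ?thesis
      using h c by (auto simp: q_def)
  next
    \<comment> \<open>The type of \<open>c\<^sub>0\<close> may be absent from \<open>Q\<close>;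
      score and threshold are then both 0.\<close>
    case False
    have "\<theta> * real (card (q h)) / real (max_count G P r ptype h c\<^sub>0) \<le> 0" for h
      using False by (intro divide_nonpos_nonneg mult_nonpos_nonneg) auto
    moreover have "0 \<le> s h c\<^sub>0" for h
      by (simp add: s_def sum_nonneg cos_sim_poi_vec_nonneg)
    ultimately have "candidate G P r ptype poi Q \<theta> (ptype c\<^sub>0) c\<^sub>0"
      using type_c\<^sub>0 order_trans by (fastforce simp: candidate_def s_def q_def)
    then show ?thesis
      using c\<^sub>0 type_c\<^sub>0 False by (auto simp: patterns_of_type_def)
  qed
qed

end
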